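(* Suppose that a maximal equiangular tight frame exists in $\mathbb C^m$, and let $\Phi$ be such a frame (so $N=m^2$). Any set of $n$ distinct points of $\{1,\dots,N\}$ and positive weights satisfying the weighted $L_2$ Marcinkiewicz--Zygmund inequality on the $m$-dimensional space $\mathcal F_\Phi$ with distortion $0\le\varepsilon<1$ obeys $$n\ge\max\Big\{m,\frac{m^2(1-\varepsilon^2)}{1+m\varepsilon^2}\Big\}.$$ Conditional on Zauner's conjecture (that a maximal equiangular tight frame exists in $\mathbb C^m$ for every $m$), this holds in every dimension $m$.
   Context: An equiangular tight frame (ETF) for $\mathbb C^m$ is a family $\Phi=\{\boldsymbol\varphi_1,\dots,\boldsymbol\varphi_N\}\subset\mathbb C^m$ of unit vectors such that $|\langle\boldsymbol\varphi_i,\boldsymbol\varphi_j\rangle|$ is the same constant for all $i\ne j$ and $\sum_{i=1}^N|\langle\boldsymbol a,\boldsymbol\varphi_i\rangle|^2=\frac Nm\|\boldsymbol a\|_2^2$ for all $\boldsymbol a\in\mathbb C^m$. A maximal ETF in $\mathbb C^m$ is an ETF with exactly $N=m^2$ vectors. On $\Omega=\{1,\dots,N\}$ with the counting measure define $\mathcal F_\Phi=\{f_{\boldsymbol a}:\Omega\to\mathbb C,\ f_{\boldsymbol a}(i)=\sqrt{m/N}\,\langle\boldsymbol a,\boldsymbol\varphi_i\rangle\,:\ \boldsymbol a\in\mathbb C^m\}$, with $\|f\|_{L_2}^2=\sum_{i=1}^N|f(i)|^2$. Distinct points $x_1,\dots,x_n\in\Omega$ and weights $w_1,\dots,w_n>0$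 satisfy the weighted $L_2$ Marcinkiewicz--Zygmund inequality on $\mathcal F_\Phi$ with distortion $\varepsilon$ if $(1-\varepsilon)\|f\|_{L_2}^2\le\sum_{i=1}^nw_i|f(x_i)|^2\le(1+\varepsilon)\|f\|_{L_2}^2$ for all $f\in\mathcal F_\Phi$. *)

theory Defs
  imports Complex_Main "HOL-Library.FuncSet" "Jordan_Normal_Form.Matrix"
begin

text \<open>
  \<open>\<complex>\<^sup>m\<close> is \<^term>\<open>carrier_vec m :: complex vec set\<close>, so that the dimension can be quantified
  over inside a formula; the inner product is \<open>a \<bullet>c b = (\<Sum>i<m. a\<^sub>i * cnj b\<^sub>i)\<close>.
  A family \<open>\<phi>\<^sub>1, \<dots>, \<phi>\<^sub>N\<close> is a function on \<^typ>\<open>nat\<close> of which only the values on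
  \<^term>\<open>{1..N}\<close> matter.
\<close>

definition vec_norm2_sq :: "complex vec \<Rightarrow> real" where
  "vec_norm2_sq a = (\<Sum>k<dim_vec a. (cmod (a $ k))\<^sup>2)"

definition equiangular_tight_frame :: "nat \<Rightarrow> nat \<Rightarrow> (nat \<Rightarrow> complex vec) \<Rightarrow> bool" where
  "equiangular_tight_frame m N \<Phi> \<longleftrightarrow>
     (\<forall>i\<in>{1..N}. \<Phi> i \<in> carrier_vec m \<and> vec_norm2_sq (\<Phi> i) = 1) \<and>
     (\<exists>c. \<forall>i\<in>{1..N}. \<forall>j\<in>{1..N}. i \<noteq> j \<longrightarrow> cmod (\<Phi> i \<bullet>c \<Phi> j) = c) \<and>
     (\<forall>a\<in>carrier_vec m.
        (\<Sum>i=1..N. (cmod (a \<bullet>c \<Phi> i))\<^sup>2) = real N / real m * vec_norm2_sq a)"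

definition maximal_etf :: "nat \<Rightarrow> (nat \<Rightarrow> complex vec) \<Rightarrow> bool" where
  "maximal_etf m \<Phi> \<longleftrightarrow> equiangular_tight_frame m (m\<^sup>2) \<Phi>"

definition zauner_conjecture :: bool where
  "zauner_conjecture \<longleftrightarrow> (\<forall>m\<ge>1. \<exists>\<Phi>. maximal_etf m \<Phi>)"

text \<open>Functions on \<open>\<Omega> = {1..N}\<close> are extensional: \<^const>\<open>undefined\<close> outside \<open>\<Omega>\<close>.\<close>

definition frame_function ::
    "nat \<Rightarrow> nat \<Rightarrow> (nat \<Rightarrow> complex vec) \<Rightarrow> complex vec \<Rightarrow> nat \<Rightarrow> complex" where
  "frame_function m N \<Phi> a =
     (\<lambda>i\<in>{1..N}. complex_of_real (sqrt (real m / real N)) * (a \<bullet>c \<Phi> i))"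

definition frame_space :: "nat \<Rightarrow> nat \<Rightarrow> (nat \<Rightarrow> complex vec) \<Rightarrow> (nat \<Rightarrow> complex) set" where
  "frame_space m N \<Phi> = frame_function m N \<Phi> ` carrier_vec m"

definition L2_norm_sq :: "nat \<Rightarrow> (nat \<Rightarrow> complex) \<Rightarrow> real" where
  "L2_norm_sq N f = (\<Sum>i=1..N. (cmod (f i))\<^sup>2)"

definition weighted_MZ ::
    "nat \<Rightarrow> (nat \<Rightarrow> complex) set \<Rightarrow> real \<Rightarrow> nat \<Rightarrow> (nat \<Rightarrow> nat) \<Rightarrow> (nat \<Rightarrow> real) \<Rightarrow> bool" where
  "weighted_MZ N F \<epsilon> n x w \<longleftrightarrow>
     x ` {1..n} \<subseteq> {1..N} \<and> inj_on x {1..n} \<and> (\<forall>i\<in>{1..n}. 0 < w i) \<and>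
     (\<forall>f\<in>F. (1 - \<epsilon>) * L2_norm_sq N f \<le> (\<Sum>i=1..n. w i * (cmod (f (x i)))\<^sup>2) \<and>
            (\<Sum>i=1..n. w i * (cmod (f (x i)))\<^sup>2) \<le> (1 + \<epsilon>) * L2_norm_sq N f)"

end

theory Submission
  imports Defs "HOL-Analysis.Convex" "Jordan_Normal_Form.Determinant"
begin

text \<open>
  Let \<open>p\<^sub>i = \<phi>\<^bsub>x\<^sub>i\<^esub>\<close> be the sampled frame vectors, \<open>v\<^sub>i = w\<^sub>i / m\<close>, and
  \<open>T = \<Sum>\<^sub>i v\<^sub>i p\<^sub>i p\<^sub>i\<^sup>*\<close> the frame operator of the weighted sample. Tightness gives
  \<open>\<parallel>f\<^sub>a\<parallel>\<^sup>2 = \<parallel>a\<parallel>\<^sup>2\<close>, so the Marcinkiewicz--Zygmund inequality says precisely that the Hermitian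
  matrix \<open>T - I\<close> has quadratic form at most \<open>\<epsilon> \<parallel>a\<parallel>\<^sup>2\<close> in absolute value.

  For \<open>n \<ge> m\<close>: fewer than \<open>m\<close> vectors leave some \<open>a \<noteq> 0\<close> orthogonal to all of them, and the
  lower inequality fails at \<open>a\<close> because \<open>\<epsilon> < 1\<close>.

  For the other bound: every column of \<open>T - I\<close> has norm at most \<open>\<epsilon>\<close>
  (\<open>hermitian_column_bound\<close>), hence \<open>tr T\<^sup>2 - 2 tr T + m = \<parallel>T - I\<parallel>\<^sub>F\<^sup>2 \<le> m \<epsilon>\<^sup>2\<close>
  (\<open>frame_operator_defect_bound\<close>). If the \<open>p\<^sub>i\<close> are unit vectors with
  \<open>\<bar>\<langle>p\<^sub>i, p\<^sub>j\<rangle>\<bar>\<^sup>2 = c\<close> for \<open>i \<noteq> j\<close>, then \<open>tr T = S := \<Sum>\<^sub>i v\<^sub>i\<close>, and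
  \<open>tr T\<^sup>2 = c S\<^sup>2 + (1 - c) \<Sum>\<^sub>i v\<^sub>i\<^sup>2 \<ge> (c + (1 - c) / n) S\<^sup>2\<close> by the Cauchy--Schwarz inequality.
  So the quadratic \<open>(c + (1 - c) / n) S\<^sup>2 - 2 S + m (1 - \<epsilon>\<^sup>2)\<close> takes a nonpositive value, and
  its discriminant is nonnegative: \<open>m (1 - \<epsilon>\<^sup>2) (c + (1 - c) / n) \<le> 1\<close>
  (\<open>equiangular_sampling_bound\<close>). Tightness forces \<open>c = 1 / (m + 1)\<close> for a maximal frame
  with \<open>m \<ge> 2\<close> (\<open>maximal_etf_coherence\<close>); for \<open>m = 1\<close> there is a single vector, and any \<open>c\<close> will
  do. Rearranging gives the stated bound on \<open>n\<close>.
\<close>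

section \<open>Hermitian matrices with small quadratic form\<close>

text \<open>
  A form of the fact that the operator norm of a Hermitian matrix is its numerical radius,
  obtained by polarization instead of diagonalization.
\<close>

lemma hermitian_column_bound:
  fixes A :: "nat \<Rightarrow> nat \<Rightarrow> complex" and \<epsilon> :: real
  assumes herm: "\<And>j k. j < m \<Longrightarrow> k < m \<Longrightarrow> A k j = cnj (A j k)"
    and bound: "\<And>a. \<bar>Re (\<Sum>j<m. \<Sum>k<m. cnj (a j) * A j k * a k)\<bar> \<le> \<epsilon> * (\<Sum>k<m. (cmod (a k))\<^sup>2)"
    and "0 \<le> \<epsilon>" "l < m"
  shows "(\<Sum>j<m. (cmod (A j l))\<^sup>2) \<le> \<epsilon>\<^sup>2"
proof -
  define B where "B a b = (\<Sum>j<m. \<Sum>k<m. cnj (a j) * A j k * b k)" for a b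
  define e :: "nat \<Rightarrow> complex" where "e = (\<lambda>k. if k = l then 1 else 0)"
  define b where "b = (\<lambda>j. A j l)"
  define s where "s = (\<Sum>j<m. (cmod (A j l))\<^sup>2)"
  have Bbe: "B b e = of_real s"
  proof -
    have "B b e = (\<Sum>j<m. cnj (A j l) * A j l)"
      unfolding B_def e_def b_def using \<open>l < m\<close> by (simp add: sum.delta if_distrib cong: if_cong)
    also have "\<dots> = of_real s"
      unfolding s_def of_real_sum
      by (intro sum.cong refl) (simp add: complex_norm_square mult.commute del: of_real_power)
    finally show ?thesis .
  qed
  have "B e b = cnj (B b e)"
  proof -
    have "cnj (B b e) = (\<Sum>j<m. \<Sum>k<m. b j * cnj (A j k) * cnj (e k))"
      by (simp add: B_def)
    also have "\<dots> = (\<Sum>j<m. \<Sum>k<m. b j * A k j * cnj (e k))"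
      by (intro sum.cong refl) (simp add: herm[symmetric])
    also have "\<dots> = (\<Sum>k<m. \<Sum>j<m. b j * A k j * cnj (e k))"
      by (rule sum.swap)
    also have "\<dots> = B e b"
      by (simp add: B_def mult_ac)
    finally show ?thesis by simp
  qed
  then have Beb: "B e b = of_real s"
    using Bbe by simp
  \<comment> \<open>Polarization between the basis vector \<open>e\<close> and \<open>t\<close> times its image \<open>b = A e\<close>, combined with
     the parallelogram law; \<open>t = 1 / \<epsilon>\<close> is the optimal choice.\<close>
  have key: "2 * t * s \<le> \<epsilon> * (1 + t\<^sup>2 * s)" for t :: real
  proof -
    define p where "p = (\<lambda>k. e k + of_real t * b k)"
    define q where "q = (\<lambda>k. e k - of_real t * b k)"
    have "B p p - B q q = 2 * of_real t * (B e b + B b e)"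
      unfolding B_def p_def q_def sum_subtractf[symmetric] sum.distrib[symmetric] sum_distrib_left
      by (intro sum.cong refl) (simp add: algebra_simps)
    then have "Re (B p p) - Re (B q q) = 4 * t * s"
      unfolding Bbe Beb by (simp flip: minus_complex.sel)
    moreover have "\<bar>Re (B p p)\<bar> \<le> \<epsilon> * (\<Sum>k<m. (cmod (p k))\<^sup>2)"
      "\<bar>Re (B q q)\<bar> \<le> \<epsilon> * (\<Sum>k<m. (cmod (q k))\<^sup>2)"
      unfolding B_def by (rule bound)+
    moreover have "(\<Sum>k<m. (cmod (p k))\<^sup>2) + (\<Sum>k<m. (cmod (q k))\<^sup>2) = 2 * (1 + t\<^sup>2 * s)"
    proof -
      have par: "(cmod (x + y))\<^sup>2 + (cmod (x - y))\<^sup>2 = 2 * (cmod x)\<^sup>2 + 2 * (cmod y)\<^sup>2" for x y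
        unfolding cmod_power2 by (simp add: power2_eq_square algebra_simps)
      have "(\<Sum>k<m. (cmod (p k))\<^sup>2) + (\<Sum>k<m. (cmod (q k))\<^sup>2)
          = 2 * (\<Sum>k<m. (cmod (e k))\<^sup>2) + 2 * (\<Sum>k<m. (cmod (of_real t * b k))\<^sup>2)"
        unfolding p_def q_def sum.distrib[symmetric] par sum_distrib_left ..
      also have "(\<Sum>k<m. (cmod (e k))\<^sup>2) = (\<Sum>k<m. if k = l then 1 else 0)"
        by (intro sum.cong refl) (simp add: e_def)
      also have "\<dots> = 1"
        using \<open>l < m\<close> by simp
      also have "(\<Sum>k<m. (cmod (of_real t * b k))\<^sup>2) = t\<^sup>2 * s"
        by (simp add: s_def b_def norm_mult power_mult_distrib sum_distrib_left)
      finally show ?thesis by simp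
    qed
    then have "\<epsilon> * (\<Sum>k<m. (cmod (p k))\<^sup>2) + \<epsilon> * (\<Sum>k<m. (cmod (q k))\<^sup>2) = \<epsilon> * (2 * (1 + t\<^sup>2 * s))"
      by (simp flip: distrib_left)
    ultimately have "4 * t * s \<le> \<epsilon> * (2 * (1 + t\<^sup>2 * s))"
      by linarith
    then show ?thesis by (simp add: algebra_simps)
  qed
  show ?thesis
    unfolding s_def[symmetric]
  proof (cases "\<epsilon> = 0")
    case True
    then show "s \<le> \<epsilon>\<^sup>2" using key[of 1] by simp
  next
    case False
    with \<open>0 \<le> \<epsilon>\<close> have "\<epsilon> > 0" by simp
    then show "s \<le> \<epsilon>\<^sup>2" using key[of "1 / \<epsilon>"]
      by (simp add: field_simps power2_eq_square)
  qed
qed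

section \<open>The frame operator of a weighted family of vectors\<close>

text \<open>
  The Frobenius norm of \<open>\<Sum>\<^sub>i v\<^sub>i p\<^sub>i p\<^sub>i\<^sup>*\<close> in terms of the Gram matrix of the vectors \<open>p\<^sub>i\<close>.
\<close>

lemma frame_operator_frobenius:
  fixes v :: "'i \<Rightarrow> real" and p :: "'i \<Rightarrow> nat \<Rightarrow> complex"
  shows "(\<Sum>j<m. \<Sum>k<m. (cmod (\<Sum>i\<in>I. of_real (v i) * p i j * cnj (p i k)))\<^sup>2)
       = (\<Sum>i\<in>I. \<Sum>i'\<in>I. v i * v i' * (cmod (\<Sum>k<m. p i k * cnj (p i' k)))\<^sup>2)" (is "?L = ?R")
proof -
  have "complex_of_real ?L = (\<Sum>j<m. \<Sum>k<m. \<Sum>i\<in>I. \<Sum>i'\<in>I.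
      of_real (v i * v i') * ((p i j * cnj (p i' j)) * cnj (p i k * cnj (p i' k))))"
    unfolding of_real_sum complex_norm_square cnj_sum sum_product
    by (intro sum.cong refl) simp
  also have "\<dots> = (\<Sum>j<m. \<Sum>i\<in>I. \<Sum>k<m. \<Sum>i'\<in>I.
      of_real (v i * v i') * ((p i j * cnj (p i' j)) * cnj (p i k * cnj (p i' k))))"
    by (intro sum.cong refl sum.swap)
  also have "\<dots> = (\<Sum>i\<in>I. \<Sum>j<m. \<Sum>k<m. \<Sum>i'\<in>I.
      of_real (v i * v i') * ((p i j * cnj (p i' j)) * cnj (p i k * cnj (p i' k))))"
    by (rule sum.swap)
  also have "\<dots> = (\<Sum>i\<in>I. \<Sum>j<m. \<Sum>i'\<in>I. \<Sum>k<m.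
      of_real (v i * v i') * ((p i j * cnj (p i' j)) * cnj (p i k * cnj (p i' k))))"
    by (intro sum.cong refl sum.swap)
  also have "\<dots> = (\<Sum>i\<in>I. \<Sum>i'\<in>I. \<Sum>j<m. \<Sum>k<m.
      of_real (v i * v i') * ((p i j * cnj (p i' j)) * cnj (p i k * cnj (p i' k))))"
    by (intro sum.cong refl sum.swap)
  also have "\<dots> = complex_of_real ?R"
    unfolding of_real_sum of_real_mult complex_norm_square cnj_sum sum_product
    unfolding sum_distrib_left ..
  finally show ?thesis
    using of_real_eq_iff by blast
qed

text \<open>
  The left-hand side of the conclusion is \<open>\<parallel>T - I\<parallel>\<^sub>F\<^sup>2\<close> for \<open>T = \<Sum>\<^sub>i v\<^sub>i p\<^sub>i p\<^sub>i\<^sup>*\<close>.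
\<close>

lemma frame_operator_defect_bound:
  fixes v :: "'i \<Rightarrow> real" and p :: "'i \<Rightarrow> nat \<Rightarrow> complex" and \<epsilon> :: real
  assumes unit: "\<And>i. i \<in> I \<Longrightarrow> (\<Sum>k<m. (cmod (p i k))\<^sup>2) = 1"
    and bound: "\<And>a. \<bar>(\<Sum>i\<in>I. v i * (cmod (\<Sum>k<m. a k * cnj (p i k)))\<^sup>2) - (\<Sum>k<m. (cmod (a k))\<^sup>2)\<bar>
        \<le> \<epsilon> * (\<Sum>k<m. (cmod (a k))\<^sup>2)"
    and "0 \<le> \<epsilon>"
  shows "(\<Sum>i\<in>I. \<Sum>i'\<in>I. v i * v i' * (cmod (\<Sum>k<m. p i k * cnj (p i' k)))\<^sup>2)
       - 2 * (\<Sum>i\<in>I. v i) + real m \<le> real m * \<epsilon>\<^sup>2"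
proof -
  define T where "T j k = (\<Sum>i\<in>I. of_real (v i) * p i j * cnj (p i k))" for j k
  define A where "A j k = T j k - (if j = k then 1 else 0)" for j k
  have herm: "A k j = cnj (A j k)" for j k
    by (auto simp: A_def T_def mult_ac)
  have form: "(\<Sum>j<m. \<Sum>k<m. cnj (a j) * A j k * a k)
      = of_real ((\<Sum>i\<in>I. v i * (cmod (\<Sum>k<m. a k * cnj (p i k)))\<^sup>2) - (\<Sum>k<m. (cmod (a k))\<^sup>2))"
    for a
  proof -
    have "(\<Sum>j<m. \<Sum>k<m. cnj (a j) * A j k * a k)
        = (\<Sum>j<m. \<Sum>k<m. cnj (a j) * T j k * a k) - (\<Sum>j<m. \<Sum>k<m. if j = k then cnj (a j) * a k else 0)"
      unfolding sum_subtractf[symmetric]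
      by (intro sum.cong refl) (simp add: A_def algebra_simps)
    also have "(\<Sum>j<m. \<Sum>k<m. if j = k then cnj (a j) * a k else 0) = of_real (\<Sum>k<m. (cmod (a k))\<^sup>2)"
      by (simp add: sum.delta complex_norm_square mult.commute del: of_real_power)
    also have "(\<Sum>j<m. \<Sum>k<m. cnj (a j) * T j k * a k)
        = (\<Sum>j<m. \<Sum>k<m. \<Sum>i\<in>I. of_real (v i) * ((a k * cnj (p i k)) * cnj (a j * cnj (p i j))))"
      unfolding T_def sum_distrib_left sum_distrib_right
      by (intro sum.cong refl) simp
    also have "\<dots> = (\<Sum>j<m. \<Sum>i\<in>I. \<Sum>k<m. of_real (v i) * ((a k * cnj (p i k)) * cnj (a j * cnj (p i j))))"
      by (intro sum.cong refl sum.swap)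
    also have "\<dots> = (\<Sum>i\<in>I. \<Sum>j<m. \<Sum>k<m. of_real (v i) * ((a k * cnj (p i k)) * cnj (a j * cnj (p i j))))"
      by (rule sum.swap)
    also have "\<dots> = (\<Sum>i\<in>I. \<Sum>k<m. \<Sum>j<m. of_real (v i) * ((a k * cnj (p i k)) * cnj (a j * cnj (p i j))))"
      by (intro sum.cong refl sum.swap)
    also have "\<dots> = of_real (\<Sum>i\<in>I. v i * (cmod (\<Sum>k<m. a k * cnj (p i k)))\<^sup>2)"
      unfolding of_real_sum of_real_mult complex_norm_square cnj_sum sum_product
    unfolding sum_distrib_left ..
    finally show ?thesis by simp
  qed
  have "(\<Sum>j<m. (cmod (A j l))\<^sup>2) \<le> \<epsilon>\<^sup>2" if "l < m" for l
    using herm _ \<open>0 \<le> \<epsilon>\<close> that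
    by (rule hermitian_column_bound) (unfold form Re_complex_of_real, rule bound)
  then have "(\<Sum>l<m. \<Sum>j<m. (cmod (A j l))\<^sup>2) \<le> (\<Sum>l<m. \<epsilon>\<^sup>2)"
    by (intro sum_mono) simp
  then have "(\<Sum>l<m. \<Sum>j<m. (cmod (A j l))\<^sup>2) \<le> real m * \<epsilon>\<^sup>2"
    by simp
  moreover have "(\<Sum>l<m. \<Sum>j<m. (cmod (A j l))\<^sup>2)
      = (\<Sum>l<m. \<Sum>j<m. (cmod (T j l))\<^sup>2) - 2 * (\<Sum>l<m. Re (T l l)) + real m"
  proof -
    have "(cmod (A j l))\<^sup>2 = (cmod (T j l))\<^sup>2 - (if j = l then 2 * Re (T j l) - 1 else 0)" for j l
      unfolding A_def cmod_power2 by (auto simp: power2_eq_square algebra_simps)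
    then show ?thesis
      by (simp add: sum_subtractf sum.delta sum_distrib_left)
  qed
  moreover have "(\<Sum>l<m. Re (T l l)) = (\<Sum>i\<in>I. v i)"
  proof -
    have "Re (T l l) = (\<Sum>i\<in>I. v i * (cmod (p i l))\<^sup>2)" for l
      unfolding T_def Re_sum cmod_power2
      by (intro sum.cong refl) (simp add: power2_eq_square algebra_simps)
    then have "(\<Sum>l<m. Re (T l l)) = (\<Sum>l<m. \<Sum>i\<in>I. v i * (cmod (p i l))\<^sup>2)"
      by simp
    also have "\<dots> = (\<Sum>i\<in>I. \<Sum>l<m. v i * (cmod (p i l))\<^sup>2)"
      by (rule sum.swap)
    also have "\<dots> = (\<Sum>i\<in>I. v i)"
      by (intro sum.cong refl) (simp add: sum_distrib_left[symmetric] unit)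
    finally show ?thesis .
  qed
  moreover have "(\<Sum>l<m. \<Sum>j<m. (cmod (T j l))\<^sup>2)
      = (\<Sum>i\<in>I. \<Sum>i'\<in>I. v i * v i' * (cmod (\<Sum>k<m. p i k * cnj (p i' k)))\<^sup>2)"
    unfolding T_def by (subst sum.swap) (rule frame_operator_frobenius)
  ultimately show ?thesis by simp
qed

text \<open>
  Here \<open>c\<close> is the common squared modulus of the inner products, and the weights \<open>v\<close> may have any
  sign.
\<close>

lemma equiangular_sampling_bound:
  fixes v :: "'i \<Rightarrow> real" and p :: "'i \<Rightarrow> nat \<Rightarrow> complex" and \<epsilon> c :: real
  assumes fin: "finite I" and ne: "I \<noteq> {}"
    and unit: "\<And>i. i \<in> I \<Longrightarrow> (\<Sum>k<m. (cmod (p i k))\<^sup>2) = 1"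
    and equi: "\<And>i i'. i \<in> I \<Longrightarrow> i' \<in> I \<Longrightarrow> i \<noteq> i' \<Longrightarrow> (cmod (\<Sum>k<m. p i k * cnj (p i' k)))\<^sup>2 = c"
    and c: "0 \<le> c" "c \<le> 1"
    and bound: "\<And>a. \<bar>(\<Sum>i\<in>I. v i * (cmod (\<Sum>k<m. a k * cnj (p i k)))\<^sup>2) - (\<Sum>k<m. (cmod (a k))\<^sup>2)\<bar>
        \<le> \<epsilon> * (\<Sum>k<m. (cmod (a k))\<^sup>2)"
    and "0 \<le> \<epsilon>"
  shows "real m * (1 - \<epsilon>\<^sup>2) * (1 - c + c * card I) \<le> card I"
proof -
  define S where "S = (\<Sum>i\<in>I. v i)"
  define Q where "Q = (\<Sum>i\<in>I. (v i)\<^sup>2)"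
  define n where "n = real (card I)"
  have n: "n > 0"
    using fin ne by (simp add: n_def card_gt_0_iff)
  have self: "(\<Sum>k<m. p i k * cnj (p i k)) = 1" if "i \<in> I" for i
  proof -
    have "(\<Sum>k<m. p i k * cnj (p i k)) = of_real (\<Sum>k<m. (cmod (p i k))\<^sup>2)"
      by (simp add: complex_norm_square del: of_real_power)
    then show ?thesis using unit[OF that] by simp
  qed
  have "(\<Sum>i\<in>I. \<Sum>i'\<in>I. v i * v i' * (cmod (\<Sum>k<m. p i k * cnj (p i' k)))\<^sup>2)
      = (\<Sum>i\<in>I. \<Sum>i'\<in>I. c * (v i * v i') + (if i = i' then (1 - c) * (v i * v i') else 0))"
    by (intro sum.cong refl) (auto simp: self equi algebra_simps)
  also have "\<dots> = c * S\<^sup>2 + (1 - c) * Q"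
    unfolding S_def Q_def power2_eq_square sum_product
    using fin by (simp add: sum.distrib sum.delta sum_distrib_left)
  finally have trace: "c * S\<^sup>2 + (1 - c) * Q - 2 * S + real m \<le> real m * \<epsilon>\<^sup>2"
    using frame_operator_defect_bound[OF unit bound \<open>0 \<le> \<epsilon>\<close>] by (simp add: S_def)
  have "S\<^sup>2 \<le> n * Q"
    unfolding S_def Q_def n_def using sum_squared_le_sum_of_squares[of v I] by (simp add: mult.commute)
  then have "(1 - c) * S\<^sup>2 \<le> (1 - c) * (n * Q)"
    using c by (intro mult_left_mono) auto
  moreover have "n * (c * S\<^sup>2 + (1 - c) * Q - 2 * S + real m) \<le> n * (real m * \<epsilon>\<^sup>2)"
    using trace n by (intro mult_left_mono) auto
  ultimately have quad: "(1 - c + c * n) * S\<^sup>2 - 2 * n * S + n * (real m * (1 - \<epsilon>\<^sup>2)) \<le> 0"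
    by (simp add: algebra_simps)
  have d: "1 - c + c * n > 0"
  proof (cases "c = 0")
    case False
    then have "c * n > 0" using c n by simp
    then show ?thesis using c by linarith
  qed simp
  \<comment> \<open>Completing the square in \<open>S\<close>: a real quadratic that takes a nonpositive value has
     nonnegative discriminant.\<close>
  define D where "D = 1 - c + c * n"
  define M where "M = real m * (1 - \<epsilon>\<^sup>2)"
  have "0 \<le> (D * S - n)\<^sup>2" by simp
  also have "(D * S - n)\<^sup>2 = D * (D * S\<^sup>2 - 2 * n * S + n * M) + n * (n - M * D)"
    by (simp add: power2_eq_square algebra_simps)
  also have "D * (D * S\<^sup>2 - 2 * n * S + n * M) \<le> 0"
    using quad d unfolding D_def M_def by (intro mult_nonneg_nonpos) auto
  finally have "0 \<le> n * (n - M * D)" by simp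
  then have "M * D \<le> n"
    using n by (simp add: zero_le_mult_iff)
  then show ?thesis
    by (simp add: M_def D_def n_def)
qed

section \<open>Sampling a maximal equiangular tight frame\<close>

lemma maximal_etf_coherence:
  assumes etf: "maximal_etf m \<Phi>" and m: "2 \<le> m"
    and ij: "i \<in> {1..m\<^sup>2}" "j \<in> {1..m\<^sup>2}" "i \<noteq> j"
  shows "(cmod (\<Phi> i \<bullet>c \<Phi> j))\<^sup>2 = 1 / (real m + 1)"
proof -
  have "\<exists>c. \<forall>i\<in>{1..m\<^sup>2}. \<forall>j\<in>{1..m\<^sup>2}. i \<noteq> j \<longrightarrow> cmod (\<Phi> i \<bullet>c \<Phi> j) = c"
    using etf unfolding maximal_etf_def equiangular_tight_frame_def by (elim conjE)
  then obtain c where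
    c: "\<And>i j. i \<in> {1..m\<^sup>2} \<Longrightarrow> j \<in> {1..m\<^sup>2} \<Longrightarrow> i \<noteq> j \<Longrightarrow> cmod (\<Phi> i \<bullet>c \<Phi> j) = c"
    by (elim exE) simp
  have \<Phi>i: "\<Phi> i \<in> carrier_vec m" "vec_norm2_sq (\<Phi> i) = 1"
    using etf ij unfolding maximal_etf_def equiangular_tight_frame_def by blast+
  have "\<Phi> i \<bullet>c \<Phi> i = of_real (vec_norm2_sq (\<Phi> i))"
    by (simp add: scalar_prod_def vec_norm2_sq_def complex_norm_square lessThan_atLeast0 del: of_real_power)
  then have self: "cmod (\<Phi> i \<bullet>c \<Phi> i) = 1" using \<Phi>i by simp
  \<comment> \<open>Tightness tested on the frame vector \<open>\<Phi> i\<close> itself: \<open>m = 1 + (m\<^sup>2 - 1) c\<^sup>2\<close>.\<close>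
  have "real (m\<^sup>2) / real m = (\<Sum>j=1..m\<^sup>2. (cmod (\<Phi> i \<bullet>c \<Phi> j))\<^sup>2)"
    using etf \<Phi>i unfolding maximal_etf_def equiangular_tight_frame_def by simp
  also have "\<dots> = (cmod (\<Phi> i \<bullet>c \<Phi> i))\<^sup>2 + (\<Sum>j\<in>{1..m\<^sup>2} - {i}. (cmod (\<Phi> i \<bullet>c \<Phi> j))\<^sup>2)"
    using ij by (intro sum.remove) auto
  also have "(\<Sum>j\<in>{1..m\<^sup>2} - {i}. (cmod (\<Phi> i \<bullet>c \<Phi> j))\<^sup>2) = (\<Sum>j\<in>{1..m\<^sup>2} - {i}. c\<^sup>2)"
    using ij by (intro sum.cong refl) (auto simp: c)
  also have "\<dots> = (real m ^ 2 - 1) * c\<^sup>2"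
    using ij by (simp add: of_nat_diff)
  finally have "(real m - 1) * ((real m + 1) * c\<^sup>2) = (real m - 1) * 1"
    using m self by (simp add: power2_eq_square algebra_simps)
  then have "(real m + 1) * c\<^sup>2 = 1"
    using m by (subst (asm) mult_left_cancel) auto
  then show ?thesis
    using c[OF ij] by (simp add: field_simps)
qed

lemma exists_orthogonal_vector:
  fixes p :: "nat \<Rightarrow> complex vec"
  assumes "n < m" and p: "\<And>i. i \<in> {1..n} \<Longrightarrow> p i \<in> carrier_vec m"
  obtains a where "a \<in> carrier_vec m" "a \<noteq> 0\<^sub>v m" "\<And>i. i \<in> {1..n} \<Longrightarrow> a \<bullet>c p i = 0"
proof -
  \<comment> \<open>The \<open>n\<close> linear equations are padded by zero rows to a square matrix; row \<open>0\<close> is one of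
     them, since the vectors are indexed from \<open>1\<close>.\<close>
  define c where "c i = (if i \<in> {1..n} then conjugate (p i) else 0\<^sub>v m)" for i
  define A where "A = mat\<^sub>r m m (\<lambda>i. if i = 0 then 0\<^sub>v m else c i)"
  have A: "A \<in> carrier_mat m m" by (simp add: A_def)
  have "c \<in> {0..<m} \<rightarrow> carrier_vec m"
    using p by (auto simp: c_def)
  then have "det A = 0"
    unfolding A_def using \<open>n < m\<close> by (intro det_row_0) auto
  then obtain a where a: "a \<in> carrier_vec m" "a \<noteq> 0\<^sub>v m" "A *\<^sub>v a = 0\<^sub>v m"
    using det_0_iff_vec_prod_zero[OF A] by blast
  have "a \<bullet>c p i = 0" if i: "i \<in> {1..n}" for i
  proof -
    have "i < m" using i \<open>n < m\<close> by simp
    have "row A i = conjugate (p i)"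
      using i \<open>i < m\<close> p[OF i] by (simp add: A_def c_def)
    then have "scalar_prod (conjugate (p i)) a = (A *\<^sub>v a) $ i"
      using \<open>i < m\<close> A by simp
    also have "\<dots> = 0" using a \<open>i < m\<close> by simp
    finally show ?thesis
      using a p[OF i] by (simp add: comm_scalar_prod[of a m])
  qed
  with a that show thesis by blast
qed

text \<open>
  The Marcinkiewicz--Zygmund inequality read on \<open>\<complex>\<^sup>m\<close>: the factor \<open>sqrt (m / m\<^sup>2)\<close> in the
  definition of \<open>f\<^sub>a\<close> makes \<open>a \<mapsto> f\<^sub>a\<close> an isometry and turns the weights into \<open>w\<^sub>i / m\<close>.
\<close>

lemma weighted_MZ_form_bounds:
  assumes etf: "maximal_etf m \<Phi>" and m: "1 \<le> m"
    and MZ: "weighted_MZ (m\<^sup>2) (frame_space m (m\<^sup>2) \<Phi>) \<epsilon> n x w"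
    and a: "a \<in> carrier_vec m"
  shows "(1 - \<epsilon>) * vec_norm2_sq a \<le> (\<Sum>i=1..n. w i / real m * (cmod (a \<bullet>c \<Phi> (x i)))\<^sup>2)"
    and "(\<Sum>i=1..n. w i / real m * (cmod (a \<bullet>c \<Phi> (x i)))\<^sup>2) \<le> (1 + \<epsilon>) * vec_norm2_sq a"
proof -
  define f where "f = frame_function m (m\<^sup>2) \<Phi> a"
  have f: "f \<in> frame_space m (m\<^sup>2) \<Phi>"
    using a by (simp add: f_def frame_space_def)
  have val: "(cmod (f i))\<^sup>2 = (cmod (a \<bullet>c \<Phi> i))\<^sup>2 / real m" if "i \<in> {1..m\<^sup>2}" for i
    using that m by (simp add: f_def frame_function_def norm_mult power_mult_distrib
        power2_eq_square[of "real m"])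
  have "L2_norm_sq (m\<^sup>2) f = (\<Sum>i=1..m\<^sup>2. (cmod (a \<bullet>c \<Phi> i))\<^sup>2) / real m"
    unfolding L2_norm_sq_def sum_divide_distrib by (intro sum.cong refl val)
  also have "\<dots> = vec_norm2_sq a"
    using etf a m unfolding maximal_etf_def equiangular_tight_frame_def
    by (simp add: power2_eq_square)
  finally have norm: "L2_norm_sq (m\<^sup>2) f = vec_norm2_sq a" .
  have "x i \<in> {1..m\<^sup>2}" if "i \<in> {1..n}" for i
    using MZ that unfolding weighted_MZ_def by blast
  then have "(\<Sum>i=1..n. w i * (cmod (f (x i)))\<^sup>2)
      = (\<Sum>i=1..n. w i / real m * (cmod (a \<bullet>c \<Phi> (x i)))\<^sup>2)"
    by (intro sum.cong refl) (simp only: val, simp)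
  moreover have "(1 - \<epsilon>) * L2_norm_sq (m\<^sup>2) f \<le> (\<Sum>i=1..n. w i * (cmod (f (x i)))\<^sup>2)"
    "(\<Sum>i=1..n. w i * (cmod (f (x i)))\<^sup>2) \<le> (1 + \<epsilon>) * L2_norm_sq (m\<^sup>2) f"
    using MZ f unfolding weighted_MZ_def by blast+
  ultimately show "(1 - \<epsilon>) * vec_norm2_sq a \<le> (\<Sum>i=1..n. w i / real m * (cmod (a \<bullet>c \<Phi> (x i)))\<^sup>2)"
    and "(\<Sum>i=1..n. w i / real m * (cmod (a \<bullet>c \<Phi> (x i)))\<^sup>2) \<le> (1 + \<epsilon>) * vec_norm2_sq a"
    by (simp_all only: norm)
qed

lemma weighted_MZ_dimension_bound:
  assumes etf: "maximal_etf m \<Phi>" and m: "1 \<le> m" and "\<epsilon> < 1"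
    and MZ: "weighted_MZ (m\<^sup>2) (frame_space m (m\<^sup>2) \<Phi>) \<epsilon> n x w"
  shows "m \<le> n"
proof (rule ccontr)
  assume "\<not> m \<le> n"
  then have "n < m" by simp
  have "\<Phi> (x i) \<in> carrier_vec m" if "i \<in> {1..n}" for i
    using etf MZ that unfolding maximal_etf_def equiangular_tight_frame_def weighted_MZ_def by blast
  then obtain a where a: "a \<in> carrier_vec m" "a \<noteq> 0\<^sub>v m" "\<And>i. i \<in> {1..n} \<Longrightarrow> a \<bullet>c \<Phi> (x i) = 0"
    using exists_orthogonal_vector[OF \<open>n < m\<close>, of "\<lambda>i. \<Phi> (x i)"] by blast
  obtain k where "k < m" "a $ k \<noteq> 0"
    using a(1,2) by (metis carrier_vecD eq_vecI index_zero_vec)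
  then have "0 < vec_norm2_sq a"
    unfolding vec_norm2_sq_def using a(1) by (intro sum_pos2[of _ k]) auto
  moreover have "(1 - \<epsilon>) * vec_norm2_sq a \<le> 0"
    using weighted_MZ_form_bounds(1)[OF etf m MZ a(1)] a(3) by simp
  ultimately show False
    using \<open>\<epsilon> < 1\<close> by (simp add: mult_le_0_iff)
qed

theorem maximal_etf_weighted_MZ_bound:
  assumes etf: "maximal_etf m \<Phi>" and m: "1 \<le> m" and \<epsilon>: "0 \<le> \<epsilon>" "\<epsilon> < 1"
    and MZ: "weighted_MZ (m\<^sup>2) (frame_space m (m\<^sup>2) \<Phi>) \<epsilon> n x w"
  shows "max (real m) ((real m)\<^sup>2 * (1 - \<epsilon>\<^sup>2) / (1 + real m * \<epsilon>\<^sup>2)) \<le> real n"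
proof -
  have mn: "m \<le> n"
    using weighted_MZ_dimension_bound[OF etf m \<epsilon>(2) MZ] .
  have x: "x i \<in> {1..m\<^sup>2}" if "i \<in> {1..n}" for i
    using MZ that unfolding weighted_MZ_def by blast
  have \<Phi>: "\<Phi> i \<in> carrier_vec m" "vec_norm2_sq (\<Phi> i) = 1" if "i \<in> {1..m\<^sup>2}" for i
    using etf that unfolding maximal_etf_def equiangular_tight_frame_def by blast+
  define p where "p = (\<lambda>i k. \<Phi> (x i) $ k)"
  have ip: "(\<Sum>k<m. b $ k * cnj (p i k)) = b \<bullet>c \<Phi> (x i)" if "i \<in> {1..n}" for i b
    using \<Phi>(1)[OF x[OF that]] by (simp add: scalar_prod_def p_def lessThan_atLeast0)
  have "real m * (1 - \<epsilon>\<^sup>2) * (1 - 1 / (real m + 1) + 1 / (real m + 1) * card {1..n}) \<le> card {1..n}"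
  proof (rule equiangular_sampling_bound)
    show "{1..n} \<noteq> {}" using m mn by simp
    show "(\<Sum>k<m. (cmod (p i k))\<^sup>2) = 1" if "i \<in> {1..n}" for i
      using \<Phi>[OF x[OF that]] by (simp add: p_def vec_norm2_sq_def)
    show "(cmod (\<Sum>k<m. p i k * cnj (p i' k)))\<^sup>2 = 1 / (real m + 1)"
      if "i \<in> {1..n}" "i' \<in> {1..n}" "i \<noteq> i'" for i i'
    proof -
      have "x i \<noteq> x i'"
        using MZ that unfolding weighted_MZ_def inj_on_def by blast
      \<comment> \<open>For \<open>m = 1\<close> the frame has a single vector, so there are no two distinct points.\<close>
      moreover have "2 \<le> m"
      proof (rule ccontr)
        assume "\<not> 2 \<le> m"
        then have "m = 1" using m by simp
        then show False using x[OF that(1)] x[OF that(2)] \<open>x i \<noteq> x i'\<close> by simp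
      qed
      ultimately show ?thesis
        using maximal_etf_coherence[OF etf _ x[OF that(1)] x[OF that(2)]] ip[OF that(2), of "\<Phi> (x i)"]
        by (simp add: p_def)
    qed
    show "\<bar>(\<Sum>i=1..n. w i / real m * (cmod (\<Sum>k<m. a k * cnj (p i k)))\<^sup>2) - (\<Sum>k<m. (cmod (a k))\<^sup>2)\<bar>
        \<le> \<epsilon> * (\<Sum>k<m. (cmod (a k))\<^sup>2)" for a
    proof -
      have "(\<Sum>k<m. a k * cnj (p i k)) = vec m a \<bullet>c \<Phi> (x i)" if "i \<in> {1..n}" for i
        by (subst ip[OF that, symmetric]) simp
      then have "(\<Sum>i=1..n. w i / real m * (cmod (\<Sum>k<m. a k * cnj (p i k)))\<^sup>2)
          = (\<Sum>i=1..n. w i / real m * (cmod (vec m a \<bullet>c \<Phi> (x i)))\<^sup>2)"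
        by (intro sum.cong refl) simp
      moreover have "(\<Sum>k<m. (cmod (a k))\<^sup>2) = vec_norm2_sq (vec m a)"
        by (simp add: vec_norm2_sq_def)
      ultimately show ?thesis
        using weighted_MZ_form_bounds[OF etf m MZ, of "vec m a"]
        by (simp add: abs_le_iff algebra_simps)
    qed
  qed (use \<epsilon> in auto)
  moreover have "1 - 1 / (real m + 1) + 1 / (real m + 1) * real n = (real m + real n) / (real m + 1)"
    by (simp add: add_divide_distrib[symmetric] diff_divide_eq_iff)
  ultimately have "real m * (1 - \<epsilon>\<^sup>2) * (real m + real n) \<le> real n * (real m + 1)"
    by (simp add: pos_divide_le_eq)
  then have "(real m)\<^sup>2 * (1 - \<epsilon>\<^sup>2) \<le> real n * (1 + real m * \<epsilon>\<^sup>2)"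
    by (simp add: power2_eq_square algebra_simps)
  moreover have "0 < 1 + real m * \<epsilon>\<^sup>2"
    by (simp add: add_pos_nonneg)
  ultimately have "(real m)\<^sup>2 * (1 - \<epsilon>\<^sup>2) / (1 + real m * \<epsilon>\<^sup>2) \<le> real n"
    by (simp add: pos_divide_le_eq)
  with mn show ?thesis by simp
qed

theorem corollary3p4:
  shows "(\<forall>(m::nat) \<Phi> (n::nat) x w (\<epsilon>::real).
            1 \<le> m \<and> maximal_etf m \<Phi> \<and> 0 \<le> \<epsilon> \<and> \<epsilon> < 1 \<and>
            weighted_MZ (m\<^sup>2) (frame_space m (m\<^sup>2) \<Phi>) \<epsilon> n x w \<longrightarrow>
            real n \<ge> max (real m) ((real m)\<^sup>2 * (1 - \<epsilon>\<^sup>2) / (1 + real m * \<epsilon>\<^sup>2)))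
       \<and> (zauner_conjecture \<longrightarrow>
           (\<forall>m::nat. 1 \<le> m \<longrightarrow>
              (\<exists>\<Phi>. maximal_etf m \<Phi>) \<and>
              (\<forall>\<Phi> (n::nat) x w (\<epsilon>::real).
                 maximal_etf m \<Phi> \<and> 0 \<le> \<epsilon> \<and> \<epsilon> < 1 \<and>
                 weighted_MZ (m\<^sup>2) (frame_space m (m\<^sup>2) \<Phi>) \<epsilon> n x w \<longrightarrow>
                 real n \<ge> max (real m) ((real m)\<^sup>2 * (1 - \<epsilon>\<^sup>2) / (1 + real m * \<epsilon>\<^sup>2)))))"
proof (intro conjI allI impI)
  show "\<exists>\<Phi>. maximal_etf m \<Phi>" if "zauner_conjecture" "1 \<le> m" for m
    using that by (simp add: zauner_conjecture_def)
qed (elim conjE, rule maximal_etf_weighted_MZ_bound, assumption+)+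

end
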